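(* Let $k\ge 1$ be an integer and let $G$ be a non-empty graph (i.e. a graph with at least one edge). Then the $k$-cone graph over $G$ is Hoffman colorable if and only if $G$ is a regular Hoffman colorable graph with color classes (in a Hoffman coloring) of size $\lambda_{\min}(G)^2/k$.
   Context: All graphs are finite, simple and undirected. $\lambda_{\max}(G)$ and $\lambda_{\min}(G)$ denote the largest and smallest eigenvalues of the adjacency matrix of $G$; $\chi(G)$ is the chromatic number. For a graph with at least one edge, Hoffman's bound states $\chi(G)\ge h(G):=1-\lambda_{\max}(G)/\lambda_{\min}(G)$. A connected graph $G$ with at least one edge is called Hoffman colorable if $\chi(G)=h(G)$ (without rounding). A disconnected graph is called Hoffman colorable if every connected component is Hoffman colorable and the values $\lambda_{\max}$, $\lambda_{\min}$ and $\chi$ are the same for all components. If $G$ is Hoffman colorable, every optimal proper vertex coloring (one with $\chi(G)$ colors) is called a Hoffman coloring; it is known that in a Hoffman coloring of a regular graph all color classes have equal size. The $k$-cone graph over $G$ is the graph obtained by adding a coclique (independent set) of $k$ new vertices to $G$ and joining each of these $k$ vertices to every vertex of $G$. *)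

theory Defs
  imports "Graph_Theory.Graph_Theory" "Jordan_Normal_Form.Char_Poly"
begin

text \<open>
  Finite simple undirected graphs are the symmetric digraphs of the locale \<^locale>\<open>graph\<close>:
  an edge is a pair of opposite arcs. The name \<open>connected\<close> is qualified below because
  HOL also has a topological constant of that name.
\<close>

text \<open>
  The rows and columns of the adjacency matrix are ordered by an arbitrary enumeration of the
  vertices; two choices give matrices that are conjugate by a permutation matrix, so the
  eigenvalues do not depend on it.
\<close>

definition vertex_enum :: "('a, 'b) pre_digraph \<Rightarrow> 'a list" where
  "vertex_enum G = (SOME vs. distinct vs \<and> set vs = verts G)"

definition adjacency_matrix :: "('a, 'b) pre_digraph \<Rightarrow> real mat" where
  "adjacency_matrix G =
     (let vs = vertex_enum G; n = card (verts G)
      in mat n n (\<lambda>(i, j). if vs ! i \<rightarrow>\<^bsub>G\<^esub> vs ! j then 1 else 0))"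

text \<open>Working over the reals loses no eigenvalue, since the matrix is real symmetric.\<close>

definition lambda_max :: "('a, 'b) pre_digraph \<Rightarrow> real" where
  "lambda_max G = Max {x. eigenvalue (adjacency_matrix G) x}"

definition lambda_min :: "('a, 'b) pre_digraph \<Rightarrow> real" where
  "lambda_min G = Min {x. eigenvalue (adjacency_matrix G) x}"

definition proper_coloring :: "('a, 'b) pre_digraph \<Rightarrow> nat \<Rightarrow> ('a \<Rightarrow> nat) \<Rightarrow> bool" where
  "proper_coloring G n c \<longleftrightarrow>
     (\<forall>v \<in> verts G. c v < n) \<and> (\<forall>u v. u \<rightarrow>\<^bsub>G\<^esub> v \<longrightarrow> c u \<noteq> c v)"

definition chromatic_number :: "('a, 'b) pre_digraph \<Rightarrow> nat" where
  "chromatic_number G = (LEAST n. \<exists>c. proper_coloring G n c)"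

definition color_class :: "('a, 'b) pre_digraph \<Rightarrow> ('a \<Rightarrow> nat) \<Rightarrow> nat \<Rightarrow> 'a set" where
  "color_class G c i = {v \<in> verts G. c v = i}"

definition hoffman_bound :: "('a, 'b) pre_digraph \<Rightarrow> real" where
  "hoffman_bound G = 1 - lambda_max G / lambda_min G"

definition connected_hoffman_colorable :: "('a, 'b) pre_digraph \<Rightarrow> bool" where
  "connected_hoffman_colorable G \<longleftrightarrow>
     Digraph_Component.connected G \<and> arcs G \<noteq> {} \<and>
     real (chromatic_number G) = hoffman_bound G"

text \<open>
  In a symmetric digraph the strongly connected components \<open>sccs\<close> are the connected components.
  The null graph, which is not \<open>connected\<close> and has no components, is excluded explicitly.
\<close>

definition hoffman_colorable :: "('a, 'b) pre_digraph \<Rightarrow> bool" where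
  "hoffman_colorable G \<longleftrightarrow>
     (if Digraph_Component.connected G then connected_hoffman_colorable G
      else verts G \<noteq> {} \<and>
        (\<forall>H \<in> pre_digraph.sccs G. connected_hoffman_colorable H) \<and>
        (\<forall>H \<in> pre_digraph.sccs G. \<forall>H' \<in> pre_digraph.sccs G.
           lambda_max H = lambda_max H' \<and> lambda_min H = lambda_min H' \<and>
           chromatic_number H = chromatic_number H'))"

definition hoffman_coloring :: "('a, 'b) pre_digraph \<Rightarrow> ('a \<Rightarrow> nat) \<Rightarrow> bool" where
  "hoffman_coloring G c \<longleftrightarrow>
     hoffman_colorable G \<and> proper_coloring G (chromatic_number G) c"

definition regular_graph :: "('a, 'b) pre_digraph \<Rightarrow> bool" where
  "regular_graph G \<longleftrightarrow> (\<exists>d. \<forall>v \<in> verts G. out_degree G v = d)"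

text \<open>The new vertices of the \<open>k\<close>-cone are \<open>Inr i\<close> for \<open>i < k\<close>.\<close>

definition cone_graph :: "nat \<Rightarrow> ('a, 'b) pre_digraph \<Rightarrow> ('a + nat) pair_pre_digraph" where
  "cone_graph k G =
     \<lparr> pverts = Inl ` verts G \<union> Inr ` {..<k},
       parcs = {(Inl u, Inl v) | u v. u \<rightarrow>\<^bsub>G\<^esub> v}
             \<union> {(Inl u, Inr i) | u i. u \<in> verts G \<and> i < k}
             \<union> {(Inr i, Inl u) | u i. u \<in> verts G \<and> i < k} \<rparr>"

end

theory Submission
  imports Defs "HOL-Analysis.Function_Topology"
begin

text \<open>
  If the cone \<open>C\<close> attains Hoffman's bound, equality in its proof says that for the Perron vector \<open>x\<close>
  of \<open>C\<close> and any optimal colouring, the entries of \<open>x\<close> over the neighbours of \<open>v\<close> in a colour class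
  not containing \<open>v\<close> add up to \<open>t x v\<close>, where \<open>t = - \<lambda>\<^sub>m\<^sub>i\<^sub>n(C)\<close>. Applied to the class of the
  apexes, this makes \<open>x\<close> constant on \<open>G\<close>. Hence every vertex of \<open>G\<close> has exactly \<open>t\<close> neighbours in
  each other class, and each class has size \<open>t\<^sup>2 / k\<close>. Such an equitable colouring restricts to every
  component and determines \<open>\<lambda>\<^sub>m\<^sub>a\<^sub>x\<close>, \<open>\<lambda>\<^sub>m\<^sub>i\<^sub>n = - t\<close> and \<open>\<chi>\<close> there. Conversely, for regular \<open>G\<close> the
  spectrum of the cone is that of \<open>G\<close> off the constant vector, the eigenvalue \<open>0\<close> and the roots of
  a quadratic.
\<close>

section \<open>Quadratic forms and minimizers of the Rayleigh quotient\<close>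

definition qform :: "'a set \<Rightarrow> ('a \<Rightarrow> 'a \<Rightarrow> real) \<Rightarrow> ('a \<Rightarrow> real) \<Rightarrow> real" where
  "qform V B f = (\<Sum>u\<in>V. \<Sum>v\<in>V. B u v * f u * f v)"

lemma qform_add:
  assumes sym: "\<And>u v. B u v = B v u"
  shows "qform V B (\<lambda>v. f v + t * g v) =
    qform V B f + 2 * t * (\<Sum>u\<in>V. g u * (\<Sum>v\<in>V. B u v * f v)) + t\<^sup>2 * qform V B g"
proof -
  have swap: "(\<Sum>u\<in>V. \<Sum>v\<in>V. B u v * f u * g v) = (\<Sum>u\<in>V. \<Sum>v\<in>V. B u v * g u * f v)"
    by (subst sum.swap) (simp add: sym mult_ac)
  have cross: "(\<Sum>u\<in>V. \<Sum>v\<in>V. B u v * g u * f v) = (\<Sum>u\<in>V. g u * (\<Sum>v\<in>V. B u v * f v))"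
    by (simp add: sum_distrib_left mult_ac)
  have "qform V B (\<lambda>v. f v + t * g v) =
     (\<Sum>u\<in>V. \<Sum>v\<in>V. B u v * f u * f v + t * (B u v * f u * g v) + t * (B u v * g u * f v)
        + t\<^sup>2 * (B u v * g u * g v))"
    unfolding qform_def
    by (intro sum.cong refl) (simp add: algebra_simps power2_eq_square)
  also have "\<dots> = qform V B f + t * (\<Sum>u\<in>V. \<Sum>v\<in>V. B u v * f u * g v)
      + t * (\<Sum>u\<in>V. \<Sum>v\<in>V. B u v * g u * f v) + t\<^sup>2 * qform V B g"
    by (simp add: qform_def sum.distrib sum_distrib_left)
  finally show ?thesis by (simp only: swap cross mult_2 distrib_right add.assoc)
qed

text \<open>Perturb \<open>f\<close> in the direction \<open>h\<close> = \<open>B f\<close>. The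
  form changes by \<open>2 t s + t^2 q\<close> with \<open>s\<close> the squared norm of
  \<open>h\<close>; being nonnegative for every real \<open>t\<close>, this forces
  \<open>s = 0\<close>.\<close>

lemma psd_qform_zero_imp_kernel:
  assumes fin: "finite V" and sym: "\<And>u v. B u v = B v u"
    and psd: "\<And>g. 0 \<le> qform V B g" and zero: "qform V B f = 0" and u: "u \<in> V"
  shows "(\<Sum>v\<in>V. B u v * f v) = 0"
proof -
  define h where "h = (\<lambda>u. \<Sum>v\<in>V. B u v * f v)"
  define s where "s = (\<Sum>u\<in>V. (h u)\<^sup>2)"
  define q where "q = qform V B h"
  have q: "q \<ge> 0" using psd by (simp add: q_def)
  have s: "s \<ge> 0" by (simp add: s_def sum_nonneg)
  have *: "0 \<le> 2 * t * s + t\<^sup>2 * q" for t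
  proof -
    have "0 \<le> qform V B (\<lambda>v. f v + t * h v)" by (rule psd)
    also have "\<dots> = 2 * t * s + t\<^sup>2 * q"
      unfolding qform_add[OF sym] zero by (simp add: h_def s_def q_def power2_eq_square)
    finally show ?thesis .
  qed
  have "s = 0"
  proof (rule ccontr)
    assume "s \<noteq> 0"
    with s have "s > 0" by simp
    \<comment> \<open>A small negative step for which the linear term dominates; the added 1 keeps
      the denominator positive when \<open>q = 0\<close>.\<close>
    define t where "t = - s / (q + 1)"
    have t: "t * (q + 1) = - s" using q by (simp add: t_def)
    have "2 * t * s + t\<^sup>2 * q \<le> 2 * t * s + t * (t * (q + 1))"
      by (simp add: power2_eq_square algebra_simps)
    also have "\<dots> = t * s" by (simp add: t)
    also have "\<dots> < 0" using \<open>s > 0\<close> q by (simp add: t_def divide_neg_pos mult_neg_pos)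
    finally show False using *[of t] by simp
  qed
  hence "(h u)\<^sup>2 = 0" using fin u unfolding s_def
    by (subst (asm) sum_nonneg_eq_0_iff) auto
  thus ?thesis by (simp add: h_def)
qed

lemma qform_shift:
  assumes "finite V"
  shows "qform V (\<lambda>u v. B u v - (if u = v then x else 0)) f = qform V B f - x * (\<Sum>v\<in>V. (f v)\<^sup>2)"
proof -
  have "qform V (\<lambda>u v. B u v - (if u = v then x else 0)) f =
    (\<Sum>u\<in>V. \<Sum>v\<in>V. B u v * f u * f v - (if u = v then x * f u * f v else 0))"
    unfolding qform_def by (intro sum.cong refl) (simp add: algebra_simps)
  also have "\<dots> = qform V B f - (\<Sum>u\<in>V. x * f u * f u)"
    using assms by (simp add: qform_def sum_subtractf)
  finally show ?thesis by (simp add: sum_distrib_left power2_eq_square mult_ac)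
qed

text \<open>Where the Rayleigh quotient attains its minimum \<open>x\<close>, the positive
  semidefinite form of \<open>B - x I\<close> vanishes, so the kernel lemma applies.\<close>

lemma qform_minimizer_imp_eigen:
  assumes fin: "finite V" and sym: "\<And>u v. B u v = B v u"
    and le: "\<And>g. x * (\<Sum>v\<in>V. (g v)\<^sup>2) \<le> qform V B g"
    and eq: "qform V B f = x * (\<Sum>v\<in>V. (f v)\<^sup>2)" and u: "u \<in> V"
  shows "(\<Sum>v\<in>V. B u v * f v) = x * f u"
proof -
  have "(\<Sum>v\<in>V. (B u v - (if u = v then x else 0)) * f v) = 0"
  proof (rule psd_qform_zero_imp_kernel[OF fin _ _ _ u])
    show "B u v - (if u = v then x else 0) = B v u - (if v = u then x else 0)" for u v
      using sym[of u v] by auto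
  qed (use le eq in \<open>simp_all add: qform_shift fin\<close>)
  also have "(\<Sum>v\<in>V. (B u v - (if u = v then x else 0)) * f v) =
    (\<Sum>v\<in>V. B u v * f v - (if u = v then x * f v else 0))"
    by (intro sum.cong refl) (simp add: algebra_simps)
  also have "\<dots> = (\<Sum>v\<in>V. B u v * f v) - x * f u" using fin u by (simp add: sum_subtractf)
  finally show ?thesis by simp
qed

text \<open>The form attains its minimum on the compact unit sphere, and homogeneity carries the
  inequality to all functions. This supplies an extremal eigenvalue without the spectral
  theorem.\<close>

lemma ex_qform_minimizer:
  fixes V :: "'a set"
  assumes fin: "finite V" and ne: "V \<noteq> {}"
  shows "\<exists>f x. (\<exists>v\<in>V. f v \<noteq> 0) \<and> qform V B f = x * (\<Sum>v\<in>V. (f v)\<^sup>2) \<and>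
    (\<forall>g. x * (\<Sum>v\<in>V. (g v)\<^sup>2) \<le> qform V B g)"
proof -
  \<comment> \<open>Functions live on the whole type, so they are pinned to 0 outside
    \<open>V\<close>: then \<open>K\<close> is a product of compact sets, compact by Tychonoff, and
    it contains every unit vector supported on \<open>V\<close>.\<close>
  define K where "K = PiE (UNIV :: 'a set) (\<lambda>v. if v \<in> V then {-1..1::real} else {0})"
  define S where "S = K \<inter> {f. (\<Sum>v\<in>V. (f v)\<^sup>2) = 1}"
  have "compactin (product_topology (\<lambda>i. euclidean) UNIV) K"
    unfolding K_def by (subst compactin_PiE) auto
  hence "compact K" by (simp add: euclidean_product_topology)
  have cont: "continuous_on A (\<lambda>f :: 'a \<Rightarrow> real. f v)" for v A
    by (rule continuous_on_subset[OF continuous_on_product_coordinates]) simp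
  have "compact S" unfolding S_def
    by (intro compact_Int_closed \<open>compact K\<close> closed_Collect_eq continuous_intros cont)
  obtain w where w: "w \<in> V" using ne by blast
  have "(\<lambda>v. if v = w then 1 else 0) \<in> S"
    using w fin by (auto simp: S_def K_def if_distrib[of "\<lambda>x. x\<^sup>2"] cong: if_cong)
  hence "S \<noteq> {}" by blast
  have "continuous_on S (qform V B)" unfolding qform_def
    by (intro continuous_intros cont)
  then obtain f where f: "f \<in> S" and min: "\<And>g. g \<in> S \<Longrightarrow> qform V B f \<le> qform V B g"
    using continuous_attains_inf[OF \<open>compact S\<close> \<open>S \<noteq> {}\<close>] by blast
  have f1: "(\<Sum>v\<in>V. (f v)\<^sup>2) = 1" using f by (simp add: S_def)
  have "qform V B f * (\<Sum>v\<in>V. (g v)\<^sup>2) \<le> qform V B g" for g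
  proof (cases "(\<Sum>v\<in>V. (g v)\<^sup>2) = 0")
    case True
    hence "\<And>v. v \<in> V \<Longrightarrow> g v = 0" using fin by (simp add: sum_nonneg_eq_0_iff)
    thus ?thesis using True by (simp add: qform_def)
  next
    case False
    define r where "r = sqrt (\<Sum>v\<in>V. (g v)\<^sup>2)"
    have nn: "(\<Sum>v\<in>V. (g v)\<^sup>2) \<ge> 0" by (simp add: sum_nonneg)
    have r: "r > 0" "r\<^sup>2 = (\<Sum>v\<in>V. (g v)\<^sup>2)"
      using False nn by (simp_all add: r_def less_le)
    define h where "h = (\<lambda>v. if v \<in> V then g v / r else 0)"
    have h1: "(\<Sum>v\<in>V. (h v)\<^sup>2) = 1"
    proof -
      have "(\<Sum>v\<in>V. (h v)\<^sup>2) = (\<Sum>v\<in>V. (g v)\<^sup>2) / r\<^sup>2"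
        by (simp add: h_def power_divide sum_divide_distrib)
      thus ?thesis using False r(2) by simp
    qed
    have h_le: "(h v)\<^sup>2 \<le> 1" if "v \<in> V" for v
      unfolding h1[symmetric] using fin that by (intro member_le_sum) auto
    have "h v \<in> {-1..1}" if "v \<in> V" for v
      using h_le[OF that] by (simp add: abs_square_le_1 abs_le_iff)
    hence "h \<in> S" using h1
      by (auto simp: S_def K_def) (simp add: h_def)
    hence "qform V B f \<le> qform V B h" by (rule min)
    also have "qform V B h = qform V B g / r\<^sup>2"
      by (simp add: qform_def h_def sum_divide_distrib power2_eq_square)
    finally show ?thesis using r(1) by (simp add: pos_le_divide_eq flip: r(2))
  qed
  moreover have "\<exists>v\<in>V. f v \<noteq> 0" using f1 by (rule contrapos_pp) simp
  ultimately show ?thesis using f1 by (intro exI[of _ f] exI[of _ "qform V B f"]) simp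
qed

section \<open>Eigenfunctions in place of eigenvectors of the adjacency matrix\<close>

definition adj :: "('a, 'b) pre_digraph \<Rightarrow> 'a \<Rightarrow> 'a \<Rightarrow> real" where
  "adj G u v = (if u \<rightarrow>\<^bsub>G\<^esub> v then 1 else 0)"

text \<open>Functions on vertices avoid the arbitrary enumeration behind the matrix. Values outside
  \<open>verts G\<close> are irrelevant, so one function can serve both a graph and its
  components.\<close>

definition eigenfunction :: "('a, 'b) pre_digraph \<Rightarrow> real \<Rightarrow> ('a \<Rightarrow> real) \<Rightarrow> bool" where
  "eigenfunction G x f \<longleftrightarrow> (\<exists>v\<in>verts G. f v \<noteq> 0) \<and>
     (\<forall>u\<in>verts G. (\<Sum>v\<in>verts G. adj G u v * f v) = x * f u)"

text \<open>Vectors and functions correspond along the enumeration, which is a bijection from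
  indices to vertices.\<close>

lemma eigenvalue_adjacency_matrix_iff:
  assumes fin: "finite (verts G)"
  shows "eigenvalue (adjacency_matrix G) x \<longleftrightarrow> (\<exists>f. eigenfunction G x f)"
proof -
  define vs where "vs = vertex_enum G"
  define n where "n = card (verts G)"
  have vs: "distinct vs \<and> set vs = verts G"
    unfolding vs_def vertex_enum_def
    by (rule someI_ex) (use finite_distinct_list[OF fin] in blast)
  hence len: "length vs = n" by (metis distinct_card n_def)
  have bij: "bij_betw (nth vs) {..<n} (verts G)"
    using vs len by (intro bij_betw_nth) auto
  have A: "adjacency_matrix G = mat n n (\<lambda>(i, j). adj G (vs ! i) (vs ! j))"
    by (simp add: adjacency_matrix_def adj_def vs_def n_def Let_def)
  have sum: "(\<Sum>v\<in>verts G. h v) = (\<Sum>i<n. h (vs ! i))" for h :: "'a \<Rightarrow> real"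
    using sum.reindex_bij_betw[OF bij, of h] by simp
  have in_verts: "(\<forall>u\<in>verts G. P u) \<longleftrightarrow> (\<forall>i<n. P (vs ! i))" for P
    using bij unfolding bij_betw_def by (metis imageE image_eqI lessThan_iff)
  have ev: "eigenvector (adjacency_matrix G) w x \<longleftrightarrow> eigenfunction G x f"
    if w: "w \<in> carrier_vec n" and f: "\<And>i. i < n \<Longrightarrow> f (vs ! i) = w $ i" for w f
  proof -
    have 1: "(w \<noteq> 0\<^sub>v n) \<longleftrightarrow> (\<exists>v\<in>verts G. f v \<noteq> 0)"
    proof -
      have "w = 0\<^sub>v n \<longleftrightarrow> (\<forall>v\<in>verts G. f v = 0)"
        unfolding in_verts using w f by (auto simp: vec_eq_iff)
      thus ?thesis by blast
    qed
    have 2: "adjacency_matrix G *\<^sub>v w = x \<cdot>\<^sub>v w \<longleftrightarrow>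
      (\<forall>u\<in>verts G. (\<Sum>v\<in>verts G. adj G u v * f v) = x * f u)"
      unfolding in_verts sum A using w f
      by (auto simp: vec_eq_iff scalar_prod_def lessThan_atLeast0)
    show ?thesis unfolding eigenvector_def eigenfunction_def 1[symmetric] 2[symmetric]
      using w by (simp add: A)
  qed
  show ?thesis
  proof
    assume "eigenvalue (adjacency_matrix G) x"
    then obtain w where w: "eigenvector (adjacency_matrix G) w x" by (auto simp: eigenvalue_def)
    hence "w \<in> carrier_vec n" by (simp add: eigenvector_def A)
    moreover have "w $ (the_inv_into {..<n} (nth vs) (vs ! i)) = w $ i" if "i < n" for i
      using bij that by (simp add: bij_betw_def the_inv_into_f_f)
    ultimately show "\<exists>f. eigenfunction G x f"
      using ev[of w "\<lambda>v. w $ (the_inv_into {..<n} (nth vs) v)"] w by blast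
  next
    assume "\<exists>f. eigenfunction G x f"
    then obtain f where "eigenfunction G x f" by blast
    thus "eigenvalue (adjacency_matrix G) x"
      using ev[of "vec n (\<lambda>i. f (vs ! i))" f] by (auto simp: eigenvalue_def)
  qed
qed

text \<open>These are the roots of the characteristic polynomial, which is monic and hence nonzero.
  Finiteness is what gives \<open>Max\<close> and \<open>Min\<close> in \<open>lambda_max\<close>
  and \<open>lambda_min\<close> their meaning.\<close>

lemma finite_eigenfunction_values:
  assumes "finite (verts G)"
  shows "finite {x. \<exists>f. eigenfunction G x f}"
proof -
  have A: "adjacency_matrix G \<in> carrier_mat (card (verts G)) (card (verts G))"
    by (simp add: adjacency_matrix_def Let_def)
  have "{x. \<exists>f. eigenfunction G x f} = {x. poly (char_poly (adjacency_matrix G)) x = 0}"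
    by (simp add: eigenvalue_root_char_poly[OF A] flip: eigenvalue_adjacency_matrix_iff[OF assms])
  moreover have "char_poly (adjacency_matrix G) \<noteq> 0"
    using degree_monic_char_poly[OF A] by auto
  ultimately show ?thesis by (simp add: poly_roots_finite)
qed

section \<open>Variational description of the extreme eigenvalues\<close>

context graph
begin

lemma adj_sym: "adj G u v = adj G v u"
  using graph_symmetric by (auto simp: adj_def)

lemma adj_self [simp]: "adj G u u = 0"
  using adj_not_same by (auto simp: adj_def)

lemma eigenfunction_sum_squares_pos:
  assumes "eigenfunction G x f"
  shows "(\<Sum>v\<in>verts G. (f v)\<^sup>2) > 0"
proof -
  obtain v where "v \<in> verts G" "f v \<noteq> 0" using assms by (auto simp: eigenfunction_def)
  thus ?thesis by (intro sum_pos2[of _ v]) auto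
qed

lemma qform_eigenfunction:
  assumes "eigenfunction G x f"
  shows "qform (verts G) (adj G) f = x * (\<Sum>v\<in>verts G. (f v)\<^sup>2)"
proof -
  have "qform (verts G) (adj G) f = (\<Sum>u\<in>verts G. f u * (\<Sum>v\<in>verts G. adj G u v * f v))"
    by (simp add: qform_def sum_distrib_left mult_ac)
  also have "\<dots> = (\<Sum>u\<in>verts G. f u * (x * f u))"
    using assms by (simp add: eigenfunction_def)
  finally show ?thesis by (simp add: sum_distrib_left power2_eq_square mult_ac)
qed

lemma lambda_min_eqI:
  assumes ev: "eigenfunction G x f"
    and le: "\<And>y g. eigenfunction G y g \<Longrightarrow> x \<le> y"
  shows "lambda_min G = x"
  unfolding lambda_min_def eigenvalue_adjacency_matrix_iff[OF finite_verts]
  by (rule Min_eqI) (use assms finite_eigenfunction_values[OF finite_verts] in auto)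

lemma lambda_max_eqI:
  assumes ev: "eigenfunction G x f"
    and le: "\<And>y g. eigenfunction G y g \<Longrightarrow> y \<le> x"
  shows "lambda_max G = x"
  unfolding lambda_max_def eigenvalue_adjacency_matrix_iff[OF finite_verts]
  by (rule Max_eqI) (use assms finite_eigenfunction_values[OF finite_verts] in auto)

text \<open>At an eigenfunction the form equals the eigenvalue times a positive sum of squares, so a
  lower bound on the form bounds all eigenvalues.\<close>

lemma lambda_min_eq_qformI:
  assumes ev: "eigenfunction G x f"
    and le: "\<And>g. x * (\<Sum>v\<in>verts G. (g v)\<^sup>2) \<le> qform (verts G) (adj G) g"
  shows "lambda_min G = x"
  by (rule lambda_min_eqI[OF ev])
    (use le qform_eigenfunction eigenfunction_sum_squares_pos mult_le_cancel_right_pos in metis)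

lemma lambda_max_eq_qformI:
  assumes ev: "eigenfunction G x f"
    and le: "\<And>g. qform (verts G) (adj G) g \<le> x * (\<Sum>v\<in>verts G. (g v)\<^sup>2)"
  shows "lambda_max G = x"
  by (rule lambda_max_eqI[OF ev])
    (use le qform_eigenfunction eigenfunction_sum_squares_pos mult_le_cancel_right_pos in metis)

lemma
  assumes "verts G \<noteq> {}"
  shows ex_eigenfunction_lambda_min: "\<exists>f. eigenfunction G (lambda_min G) f"
    and lambda_min_qform:
      "lambda_min G * (\<Sum>v\<in>verts G. (g v)\<^sup>2) \<le> qform (verts G) (adj G) g"
proof -
  obtain f x where f: "\<exists>v\<in>verts G. f v \<noteq> 0"
      "qform (verts G) (adj G) f = x * (\<Sum>v\<in>verts G. (f v)\<^sup>2)"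
    and min: "\<And>g. x * (\<Sum>v\<in>verts G. (g v)\<^sup>2) \<le> qform (verts G) (adj G) g"
    using ex_qform_minimizer[OF finite_verts assms, of "adj G"] by blast
  have "eigenfunction G x f"
    using f qform_minimizer_imp_eigen[OF finite_verts adj_sym min f(2)]
    by (auto simp: eigenfunction_def)
  moreover from this have "lambda_min G = x" using min by (rule lambda_min_eq_qformI)
  ultimately show "\<exists>f. eigenfunction G (lambda_min G) f"
    "lambda_min G * (\<Sum>v\<in>verts G. (g v)\<^sup>2) \<le> qform (verts G) (adj G) g"
    using min by auto
qed

lemma
  assumes "verts G \<noteq> {}"
  shows ex_eigenfunction_lambda_max: "\<exists>f. eigenfunction G (lambda_max G) f"
    and lambda_max_qform:
      "qform (verts G) (adj G) g \<le> lambda_max G * (\<Sum>v\<in>verts G. (g v)\<^sup>2)"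
    and lambda_max_maximizer: "\<lbrakk>\<exists>v\<in>verts G. g v \<noteq> 0;
      qform (verts G) (adj G) g = lambda_max G * (\<Sum>v\<in>verts G. (g v)\<^sup>2)\<rbrakk> \<Longrightarrow>
      eigenfunction G (lambda_max G) g"
proof -
  \<comment> \<open>The largest eigenvalue comes from minimizing the negated form; its minimum is
    the negative of \<open>lambda_max G\<close>.\<close>
  let ?B = "\<lambda>u v. - adj G u v"
  have neg: "qform (verts G) ?B g = - qform (verts G) (adj G) g" for g
    by (simp add: qform_def sum_negf)
  obtain f x where f: "\<exists>v\<in>verts G. f v \<noteq> 0"
      "qform (verts G) ?B f = x * (\<Sum>v\<in>verts G. (f v)\<^sup>2)"
    and min: "\<And>g. x * (\<Sum>v\<in>verts G. (g v)\<^sup>2) \<le> qform (verts G) ?B g"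
    using ex_qform_minimizer[OF finite_verts assms, of ?B] by blast
  have symB: "?B u v = ?B v u" for u v using adj_sym[of u v] by simp
  have ev: "eigenfunction G (- x) g" if g: "\<exists>v\<in>verts G. g v \<noteq> 0"
      "qform (verts G) (adj G) g = - x * (\<Sum>v\<in>verts G. (g v)\<^sup>2)" for g
  proof -
    have "qform (verts G) ?B g = x * (\<Sum>v\<in>verts G. (g v)\<^sup>2)"
      unfolding neg g(2) by simp
    from qform_minimizer_imp_eigen[OF finite_verts symB min this] g(1) show ?thesis
      by (auto simp: eigenfunction_def sum_negf minus_equation_iff)
  qed
  have le: "qform (verts G) (adj G) g \<le> - x * (\<Sum>v\<in>verts G. (g v)\<^sup>2)" for g
    using min[of g] by (simp add: neg)
  have "eigenfunction G (- x) f" using f by (intro ev) (auto simp: neg)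
  moreover from this have eq: "lambda_max G = - x" using le by (rule lambda_max_eq_qformI)
  ultimately show "\<exists>f. eigenfunction G (lambda_max G) f" by auto
  show "qform (verts G) (adj G) g \<le> lambda_max G * (\<Sum>v\<in>verts G. (g v)\<^sup>2)"
    using le by (simp add: eq)
  show "eigenfunction G (lambda_max G) g" if "\<exists>v\<in>verts G. g v \<noteq> 0"
    "qform (verts G) (adj G) g = lambda_max G * (\<Sum>v\<in>verts G. (g v)\<^sup>2)"
    using ev that by (simp add: eq)
qed

text \<open>The weak Perron-Frobenius statement: passing to absolute values keeps the sum of squares
  and does not decrease the form, so the result is again a maximizer and therefore an
  eigenfunction.\<close>

lemma ex_nonneg_eigenfunction_lambda_max:
  assumes "verts G \<noteq> {}"
  shows "\<exists>f. eigenfunction G (lambda_max G) f \<and> (\<forall>v. f v \<ge> 0)"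
proof -
  obtain f where f: "eigenfunction G (lambda_max G) f"
    using ex_eigenfunction_lambda_max[OF assms] by blast
  have "lambda_max G * (\<Sum>v\<in>verts G. \<bar>f v\<bar>\<^sup>2) = qform (verts G) (adj G) f"
    by (simp add: qform_eigenfunction[OF f])
  also have "\<dots> \<le> qform (verts G) (adj G) (\<lambda>v. \<bar>f v\<bar>)"
    unfolding qform_def
  proof (intro sum_mono)
    fix u v
    have "f u * f v \<le> \<bar>f u\<bar> * \<bar>f v\<bar>" by (metis abs_ge_self abs_mult)
    thus "adj G u v * f u * f v \<le> adj G u v * \<bar>f u\<bar> * \<bar>f v\<bar>" by (simp add: adj_def)
  qed
  finally have "eigenfunction G (lambda_max G) (\<lambda>v. \<bar>f v\<bar>)"
    using f lambda_max_qform[OF assms, of "\<lambda>v. \<bar>f v\<bar>"]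
    by (intro lambda_max_maximizer[OF assms]) (auto simp: eigenfunction_def)
  thus ?thesis by (intro exI[of _ "\<lambda>v. \<bar>f v\<bar>"]) simp
qed

text \<open>AM-GM: \<open>2 g u g v \<le> (f v / f u) (g u)\<^sup>2 + (f u / f v) (g v)\<^sup>2\<close>.\<close>
lemma pos_eigenfunction_lambda_max:
  assumes f: "eigenfunction G x f" and pos: "\<And>v. v \<in> verts G \<Longrightarrow> f v > 0"
  shows "lambda_max G = x"
proof (rule lambda_max_eq_qformI[OF f])
  fix g :: "'a \<Rightarrow> real"
  let ?h = "\<lambda>u v. adj G u v * (f v / f u * (g u)\<^sup>2)"
  have "2 * qform (verts G) (adj G) g \<le> (\<Sum>u\<in>verts G. \<Sum>v\<in>verts G. ?h u v + ?h v u)"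
    unfolding qform_def sum_distrib_left
  proof (intro sum_mono)
    fix u v assume uv: "u \<in> verts G" "v \<in> verts G"
    have "0 \<le> (f v * g u - f u * g v)\<^sup>2 / (f u * f v)"
      using uv pos[of u] pos[of v] by simp
    also have "\<dots> = f v / f u * (g u)\<^sup>2 + f u / f v * (g v)\<^sup>2 - 2 * g u * g v"
      using pos[of u] pos[of v] uv by (simp add: field_simps power2_eq_square)
    finally have "2 * g u * g v \<le> f v / f u * (g u)\<^sup>2 + f u / f v * (g v)\<^sup>2" by simp
    thus "2 * (adj G u v * g u * g v) \<le> ?h u v + ?h v u"
      using adj_sym[of u v] by (simp add: adj_def)
  qed
  also have "\<dots> = 2 * (\<Sum>u\<in>verts G. \<Sum>v\<in>verts G. ?h u v)"
    by (simp add: sum.distrib) (subst sum.swap, simp)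
  also have "(\<Sum>u\<in>verts G. \<Sum>v\<in>verts G. ?h u v) =
    (\<Sum>u\<in>verts G. (g u)\<^sup>2 / f u * (\<Sum>v\<in>verts G. adj G u v * f v))"
    by (simp add: sum_distrib_left mult_ac)
  also have "\<dots> = (\<Sum>u\<in>verts G. x * (g u)\<^sup>2)"
  proof (rule sum.cong[OF refl])
    fix u assume u: "u \<in> verts G"
    show "(g u)\<^sup>2 / f u * (\<Sum>v\<in>verts G. adj G u v * f v) = x * (g u)\<^sup>2"
      using f u pos[OF u] by (simp add: eigenfunction_def)
  qed
  finally show "qform (verts G) (adj G) g \<le> x * (\<Sum>v\<in>verts G. (g v)\<^sup>2)"
    by (simp flip: sum_distrib_left)
qed

end

section \<open>Hoffman's bound and its equality case\<close>

context graph
begin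

text \<open>
  Hoffman's bound: the form of \<open>A - \<lambda>\<^sub>m\<^sub>i\<^sub>n\<close> is nonnegative on the vectors \<open>f \<cdot> (1 - m [c = i])\<close>, \<open>i < m\<close>.
  If the bound is attained, the values sum to \<open>0\<close>, so all these vectors lie in the kernel.
\<close>
definition hoffman_vector :: "nat \<Rightarrow> ('a \<Rightarrow> nat) \<Rightarrow> ('a \<Rightarrow> real) \<Rightarrow> nat \<Rightarrow> 'a \<Rightarrow> real" where
  "hoffman_vector m c f i u = f u * (1 - (if c u = i then real m else 0))"

text \<open>Summed over \<open>i\<close>, the products of the two colour factors at \<open>u\<close>
  and \<open>v\<close> give \<open>m^2 [c u = c v] - m\<close>. Since adjacent vertices have
  different colours, the \<open>m^2\<close> part survives only on the diagonal, where it meets the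
  shift by \<open>t\<close>.\<close>

lemma sum_qform_hoffman_vector:
  assumes c: "proper_coloring G m c" and f: "eigenfunction G x f"
  shows "(\<Sum>i<m. qform (verts G) (\<lambda>u v. adj G u v - (if u = v then t else 0)) (hoffman_vector m c f i))
    = real m * ((1 - real m) * t - x) * (\<Sum>v\<in>verts G. (f v)\<^sup>2)"
proof -
  let ?V = "verts G" and ?t = t
  let ?B = "\<lambda>u v. adj G u v - (if u = v then ?t else 0)"
  let ?h = "hoffman_vector m c f"
  have cm: "c u < m" if "u \<in> ?V" for u using c that by (simp add: proper_coloring_def)
  have prod: "(\<Sum>i<m. (1 - (if c u = i then real m else 0)) * (1 - (if c v = i then real m else 0)))
    = (if c u = c v then (real m)\<^sup>2 else 0) - real m" if "u \<in> ?V" "v \<in> ?V" for u v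
  proof -
    have "(\<Sum>i<m. (1 - (if c u = i then real m else 0)) * (1 - (if c v = i then real m else 0)))
      = (\<Sum>i<m. 1 - (if c u = i then real m else 0) - (if c v = i then real m else 0)
          + (if c u = i then (if c u = c v then (real m)\<^sup>2 else 0) else 0))"
      by (intro sum.cong refl) (auto simp: algebra_simps power2_eq_square)
    also have "\<dots> = (if c u = c v then (real m)\<^sup>2 else 0) - real m"
      using cm[OF that(1)] cm[OF that(2)] by (simp add: sum.distrib sum_subtractf)
    finally show ?thesis .
  qed
  have "(\<Sum>i<m. qform ?V ?B (?h i)) = (\<Sum>i<m. \<Sum>u\<in>?V. \<Sum>v\<in>?V. ?B u v * f u * f v *
      ((1 - (if c u = i then real m else 0)) * (1 - (if c v = i then real m else 0))))"
    unfolding qform_def hoffman_vector_def by (intro sum.cong refl) (simp add: mult_ac)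
  also have "\<dots> = (\<Sum>u\<in>?V. \<Sum>v\<in>?V. \<Sum>i<m. ?B u v * f u * f v *
      ((1 - (if c u = i then real m else 0)) * (1 - (if c v = i then real m else 0))))"
    by (subst sum.swap) (intro sum.cong refl, subst sum.swap, rule refl)
  also have "\<dots> = (\<Sum>u\<in>?V. \<Sum>v\<in>?V. ?B u v * f u * f v *
      ((if c u = c v then (real m)\<^sup>2 else 0) - real m))"
    by (intro sum.cong refl) (simp add: prod flip: sum_distrib_left)
  also have "\<dots> = (\<Sum>u\<in>?V. \<Sum>v\<in>?V. (if u = v then - (real m)\<^sup>2 * ?t * (f v)\<^sup>2 else 0)
      - real m * (?B u v * f u * f v))"
  proof (intro sum.cong refl)
    fix u v
    have "c u = c v \<Longrightarrow> adj G u v = 0" using c by (auto simp: adj_def proper_coloring_def)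
    thus "?B u v * f u * f v * ((if c u = c v then (real m)\<^sup>2 else 0) - real m) =
      (if u = v then - (real m)\<^sup>2 * ?t * (f v)\<^sup>2 else 0) - real m * (?B u v * f u * f v)"
      by (simp add: algebra_simps power2_eq_square)
  qed
  also have "\<dots> = - (real m)\<^sup>2 * ?t * (\<Sum>v\<in>?V. (f v)\<^sup>2) - real m * qform ?V ?B f"
    by (simp add: sum_subtractf sum_distrib_left qform_def sum_negf)
  also have "\<dots> = real m * ((1 - real m) * t - x) * (\<Sum>v\<in>?V. (f v)\<^sup>2)"
    unfolding qform_shift[OF finite_verts] qform_eigenfunction[OF f]
    by (simp add: algebra_simps power2_eq_square)
  finally show ?thesis .
qed

text \<open>With \<open>t = lambda_min G\<close> every summand of the preceding identity is
  nonnegative; the positive factors \<open>m\<close> and the sum of squares cancel.\<close>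

lemma hoffman_bound_le:
  assumes c: "proper_coloring G m c" and f: "eigenfunction G x f" and m: "m > 0"
  shows "x \<le> (1 - real m) * lambda_min G"
proof -
  have ne: "verts G \<noteq> {}" using f by (auto simp: eigenfunction_def)
  have "0 \<le> (\<Sum>i<m. qform (verts G) (\<lambda>u v. adj G u v - (if u = v then lambda_min G else 0))
      (hoffman_vector m c f i))"
    using lambda_min_qform[OF ne] by (intro sum_nonneg) (simp add: qform_shift)
  thus ?thesis unfolding sum_qform_hoffman_vector[OF c f]
    using eigenfunction_sum_squares_pos[OF f] m by (simp add: zero_le_mult_iff)
qed

text \<open>In the equality case nonnegative forms sum to 0, so each vanishes and its vector lies in
  the kernel. The kernel equation at \<open>v\<close>, with the full neighbour sum replaced by
  \<open>x * f v\<close>, determines the part of that sum in class \<open>i\<close>.\<close>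

lemma hoffman_equality_class_sum:
  assumes c: "proper_coloring G m c" and f: "eigenfunction G x f"
    and eq: "x = (1 - real m) * lambda_min G"
    and i: "i < m" and v: "v \<in> verts G"
  shows "(\<Sum>u\<in>verts G. if c u = i then adj G v u * f u else 0) =
    (if c v = i then 0 else - lambda_min G * f v)"
proof -
  let ?V = "verts G" and ?t = "lambda_min G" and ?h = "hoffman_vector m c f i"
  let ?S = "\<Sum>u\<in>?V. if c u = i then adj G v u * f u else 0"
  have ne: "?V \<noteq> {}" using v by blast
  let ?B = "\<lambda>u v. adj G u v - (if u = v then ?t else 0)"
  have symB: "?B u v = ?B v u" for u v using adj_sym[of u v] by simp
  have psd: "0 \<le> qform ?V ?B g" for g
    using lambda_min_qform[OF ne, of g] by (simp add: qform_shift)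
  have "(\<Sum>i<m. qform ?V ?B (hoffman_vector m c f i)) = 0"
    unfolding sum_qform_hoffman_vector[OF c f] by (simp add: eq)
  hence "qform ?V ?B ?h = 0" using i psd by (simp add: sum_nonneg_eq_0_iff)
  hence "(\<Sum>u\<in>?V. ?B v u * ?h u) = 0"
    by (intro psd_qform_zero_imp_kernel[OF finite_verts symB psd _ v])
  also have "(\<Sum>u\<in>?V. ?B v u * ?h u) = (\<Sum>u\<in>?V. adj G v u * f u
      - real m * (if c u = i then adj G v u * f u else 0)
      - (if v = u then ?t * ?h u else 0))"
    unfolding hoffman_vector_def by (intro sum.cong refl) (simp add: algebra_simps)
  also have "\<dots> = x * f v - real m * ?S - ?t * ?h v"
    using f v by (simp add: sum_subtractf eigenfunction_def flip: sum_distrib_left)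
  also have "\<dots> = - real m * (?S - (if c v = i then 0 else - ?t * f v))"
    by (simp add: hoffman_vector_def eq algebra_simps)
  finally show ?thesis using i by simp
qed

section \<open>Colourings, degrees and equitable colourings\<close>

lemma proper_coloring_chromatic_number:
  obtains c where "proper_coloring G (chromatic_number G) c"
proof -
  \<comment> \<open>Numbering the vertices injectively is a proper colouring, so the
    \<open>LEAST\<close> in the chromatic number is attained.\<close>
  obtain c :: "'a \<Rightarrow> nat" where "bij_betw c (verts G) {0..<card (verts G)}"
    using ex_bij_betw_finite_nat[OF finite_verts] by blast
  hence "proper_coloring G (card (verts G)) c"
    unfolding proper_coloring_def bij_betw_def inj_on_def
    by (metis adj_in_verts adj_not_same atLeastLessThan_iff image_eqI)
  hence "\<exists>c. proper_coloring G (chromatic_number G) c"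
    unfolding chromatic_number_def by (rule LeastI[of "\<lambda>n. \<exists>c. proper_coloring G n c", OF exI])
  thus ?thesis using that by blast
qed

lemma chromatic_number_le: "proper_coloring G m c \<Longrightarrow> chromatic_number G \<le> m"
  unfolding chromatic_number_def by (rule Least_le) blast

lemma chromatic_number_ge2:
  assumes "arcs G \<noteq> {}"
  shows "chromatic_number G \<ge> 2"
proof -
  obtain u v where uv: "u \<rightarrow>\<^bsub>G\<^esub> v" using assms by (auto simp: arcs_ends_conv)
  obtain c where c: "proper_coloring G (chromatic_number G) c"
    by (rule proper_coloring_chromatic_number)
  have "c u < chromatic_number G" "c v < chromatic_number G" "c u \<noteq> c v"
    using c uv adj_in_verts[OF uv] by (auto simp: proper_coloring_def)
  thus ?thesis by linarith
qed

lemma sum_color_classes: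
  assumes "proper_coloring G m c"
  shows "(\<Sum>i<m. \<Sum>v\<in>verts G. if c v = i then h v else 0) = (\<Sum>v\<in>verts G. h v :: real)"
  by (subst sum.swap) (use assms in \<open>auto simp: proper_coloring_def intro!: sum.cong\<close>)

lemma card_color_class:
  "real (card (color_class G c i)) = (\<Sum>v\<in>verts G. if c v = i then 1 else 0)"
  by (simp add: color_class_def sum.If_cases Collect_conj_eq)

text \<open>Without parallel arcs, the arcs leaving \<open>u\<close> are counted by their
  heads.\<close>

lemma out_degree_eq_sum: "real (out_degree G u) = (\<Sum>v\<in>verts G. adj G u v)"
proof -
  have "head G ` out_arcs G u = {v \<in> verts G. u \<rightarrow>\<^bsub>G\<^esub> v}"
    by (auto simp: arcs_ends_conv image_iff)
  moreover have "inj_on (head G) (out_arcs G u)"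
    by (rule inj_onI) (auto intro!: no_multi_arcs simp: arc_to_ends_def)
  ultimately have "out_degree G u = card {v \<in> verts G. u \<rightarrow>\<^bsub>G\<^esub> v}"
    by (metis card_image out_degree_def)
  thus ?thesis by (simp add: adj_def sum.If_cases Collect_conj_eq)
qed

lemma regular_lambda_max:
  assumes "verts G \<noteq> {}" "\<And>v. v \<in> verts G \<Longrightarrow> (\<Sum>u\<in>verts G. adj G v u) = d"
  shows "lambda_max G = d"
  by (rule pos_eigenfunction_lambda_max[of _ "\<lambda>_. 1"]) (use assms in \<open>auto simp: eigenfunction_def\<close>)

text \<open>Adding the neighbours class by class gives regularity, hence
  \<open>lambda_max G\<close>. The difference of two class indicators is an eigenfunction for
  \<open>- t\<close>, which \<open>le\<close> makes the least eigenvalue. Hoffman's bound then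
  excludes fewer than \<open>m\<close> colours.\<close>

lemma equitable_coloring_spectrum:
  assumes ne: "verts G \<noteq> {}" and c: "proper_coloring G m c" and m: "m \<ge> 2" and t: "t > 0"
    and nb: "\<And>v i. \<lbrakk>v \<in> verts G; i < m; i \<noteq> c v\<rbrakk> \<Longrightarrow>
      (\<Sum>u\<in>verts G. if c u = i then adj G v u else 0) = t"
    and le: "\<And>g. - t * (\<Sum>v\<in>verts G. (g v)\<^sup>2) \<le> qform (verts G) (adj G) g"
  shows "lambda_max G = t * (real m - 1)" "lambda_min G = - t" "chromatic_number G = m"
    and "\<And>v. v \<in> verts G \<Longrightarrow> (\<Sum>u\<in>verts G. adj G v u) = t * (real m - 1)"
proof -
  let ?V = "verts G"
  have nb': "(\<Sum>u\<in>?V. if c u = i then adj G v u else 0) = (if c v = i then 0 else t)"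
    if "v \<in> ?V" "i < m" for v i
  proof (cases "c v = i")
    case True
    hence "c u = i \<Longrightarrow> adj G v u = 0" for u
      using c unfolding adj_def proper_coloring_def by metis
    hence "(\<Sum>u\<in>?V. if c u = i then adj G v u else 0) = 0"
      by (intro sum.neutral) auto
    thus ?thesis using True by simp
  next
    case False
    thus ?thesis using nb[OF that] by auto
  qed
  show deg: "(\<Sum>u\<in>?V. adj G v u) = t * (real m - 1)" if v: "v \<in> ?V" for v
  proof -
    have "(\<Sum>u\<in>?V. adj G v u) = (\<Sum>i<m. if c v = i then 0 else t)"
      by (subst sum_color_classes[OF c, symmetric]) (intro sum.cong refl nb'[OF v], simp)
    also have "\<dots> = (\<Sum>i<m. t - (if c v = i then t else 0))"
      by (intro sum.cong) auto
    also have "\<dots> = t * (real m - 1)"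
      using c v by (auto simp: sum_subtractf proper_coloring_def algebra_simps)
    finally show ?thesis .
  qed
  show max: "lambda_max G = t * (real m - 1)" by (rule regular_lambda_max[OF ne deg])
  obtain v where v: "v \<in> ?V" using ne by blast
  \<comment> \<open>Some colour other than that of \<open>v\<close>; it exists because
    \<open>m\<close> is at least 2. The class of \<open>j\<close> itself may be empty, but
    \<open>v\<close> keeps \<open>f\<close> nonzero.\<close>
  define j where "j = (if c v = 0 then 1 else (0::nat))"
  have j: "j < m" "j \<noteq> c v" using m by (auto simp: j_def)
  have cv: "c v < m" using c v by (auto simp: proper_coloring_def)
  define f where "f = (\<lambda>u. (if c u = c v then 1 else 0) - (if c u = j then 1 else (0::real)))"
  have "eigenfunction G (- t) f" unfolding eigenfunction_def
  proof (intro conjI ballI)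
    show "\<exists>v\<in>?V. f v \<noteq> 0" using v j by (intro bexI[of _ v]) (auto simp: f_def)
    fix w assume w: "w \<in> ?V"
    have "(\<Sum>u\<in>?V. adj G w u * f u) = (\<Sum>u\<in>?V. if c u = c v then adj G w u else 0)
      - (\<Sum>u\<in>?V. if c u = j then adj G w u else 0)"
      unfolding f_def sum_subtractf[symmetric] by (intro sum.cong) auto
    also have "\<dots> = - t * f w"
      unfolding nb'[OF w cv] nb'[OF w j(1)] by (auto simp: f_def)
    finally show "(\<Sum>u\<in>?V. adj G w u * f u) = - t * f w" .
  qed
  thus min: "lambda_min G = - t" using le by (rule lambda_min_eq_qformI)
  obtain c' where c': "proper_coloring G (chromatic_number G) c'"
    by (rule proper_coloring_chromatic_number)
  have "chromatic_number G > 0" using c' v by (auto simp: proper_coloring_def)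
  obtain f where "eigenfunction G (lambda_max G) f"
    using ex_eigenfunction_lambda_max[OF ne] by blast
  \<comment> \<open>The bound for an optimal colouring reads t (m - 1) \<le> t (chi - 1).\<close>
  from hoffman_bound_le[OF c' this \<open>chromatic_number G > 0\<close>]
  have "t * real m \<le> t * real (chromatic_number G)"
    by (simp add: max min algebra_simps)
  thus "chromatic_number G = m" using t chromatic_number_le[OF c] by simp
qed

section \<open>Passing between a graph and its connected components\<close>

lemma sccs_graph:
  assumes "H \<in> sccs"
  shows "graph H" "verts H \<subseteq> verts G" "verts H \<noteq> {}"
    and "\<And>u v. u \<in> verts H \<Longrightarrow> u \<rightarrow>\<^bsub>G\<^esub> v \<Longrightarrow> v \<in> verts H"
    and "\<And>u v. u \<in> verts H \<Longrightarrow> v \<in> verts H \<Longrightarrow> adj H u v = adj G u v"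
proof -
  have ind: "induced_subgraph H G" and sc: "strongly_connected H"
    using assms by (auto simp: sccs_def)
  have sub: "subgraph H G" using ind by (rule induced_imp_subgraph)
  show "graph H"
    by (rule digraph.graphI[OF digraph_subgraph[OF sub] induced_graph_imp_symmetric[OF sym_arcs ind]])
  show "verts H \<subseteq> verts G" using sub by (rule subgraph_imp_subverts)
  show "verts H \<noteq> {}" using sc by (simp add: strongly_connected_def)
  show "v \<in> verts H" if u: "u \<in> verts H" and uv: "u \<rightarrow>\<^bsub>G\<^esub> v" for u v
  proof -
    \<comment> \<open>The component of everything reachable from \<open>u\<close> contains both
      \<open>u\<close> and \<open>v\<close>; components are disjoint, so it is
      \<open>H\<close>.\<close>
    let ?K = "G \<restriction> {w. u \<rightarrow>\<^sup>* w}"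
    have K: "?K \<in> sccs" using induce_reachable_is_in_sccs adj_in_verts[OF uv] by blast
    have "u \<in> verts ?K" "v \<in> verts ?K"
      using adj_in_verts[OF uv] uv by auto
    moreover from this u have "H = ?K" using scc_disj[OF assms K] by blast
    ultimately show ?thesis by blast
  qed
  show "adj H u v = adj G u v" if "u \<in> verts H" "v \<in> verts H" for u v
  proof -
    have "tail H = tail G" "head H = head G"
      "arcs H = {e \<in> arcs G. tail G e \<in> verts H \<and> head G e \<in> verts H}"
      using ind by (simp_all add: induced_subgraph_def subgraph_def compatible_def)
    hence "arcs_ends H = arcs_ends G \<inter> verts H \<times> verts H" by (auto simp: arcs_ends_conv)
    thus ?thesis using that by (simp add: adj_def)
  qed
qed

text \<open>All neighbours of a vertex of \<open>H\<close> lie in \<open>H\<close>, so the remaining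
  vertices contribute 0.\<close>

lemma sum_scc:
  assumes "H \<in> sccs" "v \<in> verts H"
  shows "(\<Sum>u\<in>verts H. adj H v u * f u) = (\<Sum>u\<in>verts G. adj G v u * f u)"
proof -
  have "(\<Sum>u\<in>verts H. adj H v u * f u) = (\<Sum>u\<in>verts H. adj G v u * f u)"
    using assms by (intro sum.cong) (auto simp: sccs_graph(5))
  also have "\<dots> = (\<Sum>u\<in>verts G. adj G v u * f u)"
    using assms sccs_graph(2,4)[OF assms(1)]
    by (intro sum.mono_neutral_left) (auto simp: adj_def)
  finally show ?thesis .
qed

text \<open>Merges the two branches of the definition: a connected graph is its own only
  component.\<close>

lemma hoffman_colorable_iff_sccs:
  assumes "verts G \<noteq> {}"
  shows "hoffman_colorable G \<longleftrightarrow>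
     (\<forall>H\<in>sccs. connected_hoffman_colorable H) \<and>
     (\<forall>H\<in>sccs. \<forall>H'\<in>sccs. lambda_max H = lambda_max H' \<and> lambda_min H = lambda_min H' \<and>
        chromatic_number H = chromatic_number H')"
proof (cases "Digraph_Component.connected G")
  case True
  hence "sccs = {G}"
    using symmetric_connected_imp_strongly_connected[OF sym_arcs] strongly_connected_eq_iff by blast
  thus ?thesis using True by (simp add: hoffman_colorable_def)
qed (use assms in \<open>auto simp: hoffman_colorable_def\<close>)

end

context graph
begin

lemma lambda_min_le:
  assumes "eigenfunction G x f"
  shows "lambda_min G \<le> x"
proof -
  have "verts G \<noteq> {}" using assms by (auto simp: eigenfunction_def)
  from lambda_min_qform[OF this, of f] show ?thesis
    unfolding qform_eigenfunction[OF assms]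
    using eigenfunction_sum_squares_pos[OF assms] by (simp add: mult_le_cancel_right)
qed

text \<open>An eigenfunction of one component extends by 0 to \<open>G\<close>; conversely an
  eigenfunction of \<open>G\<close> is one of any component on which it does not vanish.\<close>

lemma sccs_lambda_min:
  assumes sccs: "\<And>H. H \<in> sccs \<Longrightarrow> lambda_min H = t" and ne: "verts G \<noteq> {}"
  shows "lambda_min G = t"
proof -
  obtain H where H: "H \<in> sccs" using ne scc_for_vert_ex by blast
  interpret H: graph H by (rule sccs_graph(1)[OF H])
  obtain f where f: "eigenfunction H t f"
    using H.ex_eigenfunction_lambda_min[OF sccs_graph(3)[OF H]] sccs[OF H] by auto
  define f' where "f' = (\<lambda>v. if v \<in> verts H then f v else 0)"
  have "eigenfunction G t f'" unfolding eigenfunction_def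
  proof (intro conjI ballI)
    show "\<exists>v\<in>verts G. f' v \<noteq> 0"
      using f sccs_graph(2)[OF H] by (auto simp: eigenfunction_def f'_def)
    fix v assume "v \<in> verts G"
    show "(\<Sum>u\<in>verts G. adj G v u * f' u) = t * f' v"
    proof (cases "v \<in> verts H")
      case True
      have "(\<Sum>u\<in>verts G. adj G v u * f' u) = (\<Sum>u\<in>verts H. adj H v u * f' u)"
        by (rule sum_scc[OF H True, symmetric])
      also have "\<dots> = (\<Sum>u\<in>verts H. adj H v u * f u)" by (simp add: f'_def)
      finally show ?thesis using f True by (simp add: eigenfunction_def f'_def)
    next
      case False
      have "adj G v u = 0" if "u \<in> verts H" for u
        using False sccs_graph(4)[OF H that] graph_symmetric[of v u] by (auto simp: adj_def)
      thus ?thesis using False by (auto simp: f'_def intro!: sum.neutral)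
    qed
  qed
  thus ?thesis
  proof (rule lambda_min_eqI)
    fix y g assume g: "eigenfunction G y g"
    then obtain v where v: "v \<in> verts G" "g v \<noteq> 0" by (auto simp: eigenfunction_def)
    obtain K where K: "K \<in> sccs" "v \<in> verts K" using scc_for_vert_ex[OF v(1)] by blast
    have "eigenfunction K y g" unfolding eigenfunction_def
    proof (intro conjI ballI)
      show "\<exists>v\<in>verts K. g v \<noteq> 0" using K v by blast
      fix u assume "u \<in> verts K"
      thus "(\<Sum>v\<in>verts K. adj K u v * g v) = y * g u"
        using sum_scc[OF K(1)] sccs_graph(2)[OF K(1)] g by (auto simp: eigenfunction_def)
    qed
    from graph.lambda_min_le[OF sccs_graph(1)[OF K(1)] this] show "t \<le> y"
      using sccs[OF K(1)] by simp
  qed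
qed

lemma proper_coloring_scc:
  assumes "H \<in> sccs" "proper_coloring G m c"
  shows "proper_coloring H m c"
proof -
  have "subgraph H G" using assms(1) by (auto simp: sccs_def)
  thus ?thesis using assms(2) sccs_graph(2)[OF assms(1)] arcs_ends_mono
    unfolding proper_coloring_def by blast
qed

lemma sccs_chromatic_number:
  assumes sccs: "\<And>H. H \<in> sccs \<Longrightarrow> chromatic_number H = m" and ne: "verts G \<noteq> {}"
  shows "chromatic_number G = m"
proof (rule antisym)
  obtain H where H: "H \<in> sccs" using ne scc_for_vert_ex by blast
  obtain c where "proper_coloring G (chromatic_number G) c" by (rule proper_coloring_chromatic_number)
  from proper_coloring_scc[OF H this] show "m \<le> chromatic_number G"
    using graph.chromatic_number_le[OF sccs_graph(1)[OF H]] sccs[OF H] by auto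
next
  have "\<forall>H\<in>sccs. \<exists>c. proper_coloring H m c"
    using graph.proper_coloring_chromatic_number[OF sccs_graph(1)] sccs by metis
  then obtain col where col: "\<And>H. H \<in> sccs \<Longrightarrow> proper_coloring H m (col H)" by metis
  obtain comp where comp: "\<And>v. v \<in> verts G \<Longrightarrow> comp v \<in> sccs \<and> v \<in> verts (comp v)"
    using scc_for_vert_ex by metis
  \<comment> \<open>Colourings of the components glue together, since no edge joins two
    components.\<close>
  have "proper_coloring G m (\<lambda>v. col (comp v) v)" unfolding proper_coloring_def
  proof (intro conjI ballI allI impI)
    fix v assume "v \<in> verts G"
    thus "col (comp v) v < m" using comp col by (auto simp: proper_coloring_def)
  next
    fix u v assume uv: "u \<rightarrow>\<^bsub>G\<^esub> v"
    note u = adj_in_verts(1)[OF uv] and v = adj_in_verts(2)[OF uv]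
    have H: "comp u \<in> sccs" "u \<in> verts (comp u)" using comp u by auto
    have v': "v \<in> verts (comp u)" using sccs_graph(4)[OF H uv] .
    hence "comp v = comp u" using comp[OF v] scc_disj[OF _ H(1)] by blast
    moreover have "adj (comp u) u v = adj G u v" by (rule sccs_graph(5)[OF H v'])
    hence "u \<rightarrow>\<^bsub>comp u\<^esub> v" using uv by (simp add: adj_def split: if_splits)
    ultimately show "col (comp u) u \<noteq> col (comp v) v"
      using col[OF H(1)] by (auto simp: proper_coloring_def)
  qed
  thus "chromatic_number G \<le> m" by (rule chromatic_number_le)
qed

text \<open>Hoffman colorability only speaks about components. Each is regular of the same degree
  \<open>d\<close>, which is thus its \<open>lambda_max\<close>, while \<open>lambda_min\<close> and
  the chromatic number agree with those of \<open>G\<close>.\<close>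

lemma regular_hoffman_colorable:
  assumes hc: "hoffman_colorable G" and ne: "verts G \<noteq> {}"
    and deg: "\<And>v. v \<in> verts G \<Longrightarrow> (\<Sum>u\<in>verts G. adj G v u) = d"
  shows "real (chromatic_number G) = 1 - d / lambda_min G"
proof -
  obtain H where H: "H \<in> sccs" using ne scc_for_vert_ex by blast
  have chc: "connected_hoffman_colorable H"
    and eq: "\<And>K. K \<in> sccs \<Longrightarrow> lambda_min K = lambda_min H \<and> chromatic_number K = chromatic_number H"
    using hc H unfolding hoffman_colorable_iff_sccs[OF ne] by blast+
  have "lambda_max H = d"
  proof (rule graph.regular_lambda_max[OF sccs_graph(1,3)[OF H]])
    fix v assume v: "v \<in> verts H"
    show "(\<Sum>u\<in>verts H. adj H v u) = d"
      using sum_scc[OF H v, of "\<lambda>_. 1"] deg v sccs_graph(2)[OF H] by auto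
  qed
  moreover have "lambda_min G = lambda_min H" "chromatic_number G = chromatic_number H"
    using sccs_lambda_min[OF _ ne] sccs_chromatic_number[OF _ ne] eq by blast+
  ultimately show ?thesis using chc
    by (simp add: connected_hoffman_colorable_def hoffman_bound_def)
qed

text \<open>Extension by 0 lets a component inherit lower bounds on the form of
  \<open>G\<close>.\<close>

lemma qform_extend_scc:
  assumes H: "H \<in> sccs"
  shows "qform (verts H) (adj H) g = qform (verts G) (adj G) (\<lambda>v. if v \<in> verts H then g v else 0)"
    (is "_ = qform _ _ ?g")
proof -
  have "qform (verts H) (adj H) g = (\<Sum>u\<in>verts H. g u * (\<Sum>v\<in>verts H. adj H u v * g v))"
    by (simp add: qform_def sum_distrib_left mult_ac)
  also have "\<dots> = (\<Sum>u\<in>verts H. ?g u * (\<Sum>v\<in>verts H. adj H u v * ?g v))" by simp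
  also have "\<dots> = (\<Sum>u\<in>verts H. ?g u * (\<Sum>v\<in>verts G. adj G u v * ?g v))"
    by (intro sum.cong refl arg_cong2[of _ _ _ _ "(*)"] sum_scc[OF H])
  also have "\<dots> = (\<Sum>u\<in>verts G. ?g u * (\<Sum>v\<in>verts G. adj G u v * ?g v))"
    using sccs_graph(2)[OF H] by (intro sum.mono_neutral_left) auto
  also have "\<dots> = qform (verts G) (adj G) ?g"
    unfolding qform_def sum_distrib_left by (intro sum.cong refl) (simp add: mult_ac)
  finally show ?thesis .
qed

lemma strongly_connected_imp_connected:
  assumes "strongly_connected G"
  shows "Digraph_Component.connected G"
  by (rule connectedI)
    (use assms in \<open>auto simp: strongly_connected_def intro: reachable_mk_symmetricI\<close>)

text \<open>Both \<open>nb\<close> and \<open>le\<close> restrict to every component with the same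
  \<open>m\<close> and \<open>t\<close>, so all components share the values from
  \<open>equitable_coloring_spectrum\<close>, and these attain Hoffman's bound.\<close>

lemma equitable_coloring_hoffman_colorable:
  assumes ne: "verts G \<noteq> {}" and c: "proper_coloring G m c" and m: "m \<ge> 2" and t: "t > 0"
    and nb: "\<And>v i. \<lbrakk>v \<in> verts G; i < m; i \<noteq> c v\<rbrakk> \<Longrightarrow>
      (\<Sum>u\<in>verts G. if c u = i then adj G v u else 0) = t"
    and le: "\<And>g. - t * (\<Sum>v\<in>verts G. (g v)\<^sup>2) \<le> qform (verts G) (adj G) g"
  shows "hoffman_colorable G"
proof -
  have spec: "lambda_max H = t * (real m - 1) \<and> lambda_min H = - t \<and> chromatic_number H = m \<and>
      (\<forall>v\<in>verts H. (\<Sum>u\<in>verts H. adj H v u) = t * (real m - 1))"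
    if H: "H \<in> sccs" for H
  proof -
    note Hg = sccs_graph[OF H]
    have nbH: "(\<Sum>u\<in>verts H. if c u = i then adj H v u else 0) = t"
      if "v \<in> verts H" "i < m" "i \<noteq> c v" for v i
    proof -
      have "(\<Sum>u\<in>verts H. if c u = i then adj H v u else 0) =
          (\<Sum>u\<in>verts H. adj H v u * (if c u = i then 1 else 0))"
        by (intro sum.cong) auto
      also have "\<dots> = (\<Sum>u\<in>verts G. adj G v u * (if c u = i then 1 else 0))"
        by (rule sum_scc[OF H that(1)])
      also have "\<dots> = (\<Sum>u\<in>verts G. if c u = i then adj G v u else 0)"
        by (intro sum.cong) auto
      also have "\<dots> = t" using nb Hg(2) that by blast
      finally show ?thesis .
    qed
    have leH: "- t * (\<Sum>v\<in>verts H. (g v)\<^sup>2) \<le> qform (verts H) (adj H) g" for g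
    proof -
      let ?g = "\<lambda>v. if v \<in> verts H then g v else 0"
      have "(\<Sum>v\<in>verts H. (g v)\<^sup>2) = (\<Sum>v\<in>verts G. (?g v)\<^sup>2)"
        using Hg(2) by (intro sum.mono_neutral_cong_left) auto
      thus ?thesis using le[of ?g] by (simp only: qform_extend_scc[OF H])
    qed
    note * = graph.equitable_coloring_spectrum[OF Hg(1,3) proper_coloring_scc[OF H c] m t nbH leH]
    show ?thesis using * by blast
  qed
  have "connected_hoffman_colorable H" if H: "H \<in> sccs" for H
    unfolding connected_hoffman_colorable_def
  proof (intro conjI)
    show "Digraph_Component.connected H"
      using graph.strongly_connected_imp_connected[OF sccs_graph(1)[OF H]] H
      by (auto simp: sccs_def)
    show "arcs H \<noteq> {}"
    proof
      assume "arcs H = {}"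
      \<comment> \<open>A component without arcs would have degree 0, against the positive degree
        \<open>t * (m - 1)\<close>.\<close>
      hence "adj H u v = 0" for u v by (simp add: adj_def arcs_ends_conv)
      hence "t * (real m - 1) = 0" using spec[OF H] sccs_graph(3)[OF H] by auto
      thus False using t m by simp
    qed
    show "real (chromatic_number H) = hoffman_bound H"
      using spec[OF H] t by (simp add: hoffman_bound_def)
  qed
  thus ?thesis unfolding hoffman_colorable_iff_sccs[OF ne] using spec by metis
qed

end

section \<open>The cone graph: adjacency, connectedness and chromatic number\<close>

definition cone :: "nat \<Rightarrow> ('a, 'b) pre_digraph \<Rightarrow> ('a + nat, ('a + nat) \<times> ('a + nat)) pre_digraph" where
  "cone k G = with_proj (cone_graph k G)"

lemma verts_cone: "verts (cone k G) = Inl ` verts G \<union> Inr ` {..<k}"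
  by (simp add: cone_def cone_graph_def)

lemma dominates_cone [simp]:
  "Inl u \<rightarrow>\<^bsub>cone k G\<^esub> Inl v \<longleftrightarrow> u \<rightarrow>\<^bsub>G\<^esub> v"
  "Inl u \<rightarrow>\<^bsub>cone k G\<^esub> Inr i \<longleftrightarrow> u \<in> verts G \<and> i < k"
  "Inr i \<rightarrow>\<^bsub>cone k G\<^esub> Inl u \<longleftrightarrow> u \<in> verts G \<and> i < k"
  "Inr i \<rightarrow>\<^bsub>cone k G\<^esub> Inr j \<longleftrightarrow> False"
  by (auto simp: cone_def cone_graph_def)

lemma adj_cone [simp]:
  "adj (cone k G) (Inl u) (Inl v) = adj G u v"
  "\<lbrakk>u \<in> verts G; i < k\<rbrakk> \<Longrightarrow> adj (cone k G) (Inl u) (Inr i) = 1"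
  "\<lbrakk>u \<in> verts G; i < k\<rbrakk> \<Longrightarrow> adj (cone k G) (Inr i) (Inl u) = 1"
  "adj (cone k G) (Inr i) (Inr j) = 0"
  unfolding adj_def dominates_cone by simp_all

context graph
begin

lemma graph_cone: "graph (cone k G)"
proof -
  have "finite (parcs (cone_graph k G))"
  proof (rule finite_subset)
    show "parcs (cone_graph k G) \<subseteq>
      (Inl ` verts G \<union> Inr ` {..<k}) \<times> (Inl ` verts G \<union> Inr ` {..<k})"
      by (auto simp: cone_graph_def adj_in_verts)
  qed simp
  moreover have "symmetric (with_proj (cone_graph k G))"
    by (auto simp: symmetric_def sym_def cone_graph_def graph_symmetric)
  ultimately have "pair_graph (cone_graph k G)"
    by unfold_locales (auto simp: cone_graph_def adj_in_verts dest: adj_not_same)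
  thus ?thesis unfolding cone_def by (rule pair_graph.pair_graphD_graph)
qed

lemma sum_verts_cone:
  "(\<Sum>x\<in>verts (cone k G). h x) = (\<Sum>v\<in>verts G. h (Inl v)) + (\<Sum>i<k. h (Inr i) :: real)"
  unfolding verts_cone by (subst sum.union_disjoint) (auto simp: sum.reindex)

lemma eigenfunction_cone_iff:
  "eigenfunction (cone k G) x f \<longleftrightarrow>
     ((\<exists>v\<in>verts G. f (Inl v) \<noteq> 0) \<or> (\<exists>i<k. f (Inr i) \<noteq> 0)) \<and>
     (\<forall>u\<in>verts G. (\<Sum>v\<in>verts G. adj G u v * f (Inl v)) + (\<Sum>i<k. f (Inr i)) = x * f (Inl u)) \<and>
     (\<forall>i<k. (\<Sum>v\<in>verts G. f (Inl v)) = x * f (Inr i))"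
  unfolding eigenfunction_def sum_verts_cone unfolding verts_cone by (auto simp: ball_Un)

text \<open>Every vertex reaches the apex \<open>Inr 0\<close>, the other apexes through a vertex of
  \<open>G\<close>; symmetry gives the way back. Hence the definition of Hoffman colorability for
  the cone involves no components.\<close>

lemma strongly_connected_cone:
  assumes "k \<ge> 1" and ne: "verts G \<noteq> {}"
  shows "strongly_connected (cone k G)"
proof (rule strongly_connectedI)
  interpret C: graph "cone k G" by (rule graph_cone)
  show "verts (cone k G) \<noteq> {}" using ne by (auto simp: verts_cone)
  obtain w where w: "w \<in> verts G" using ne by blast
  have apex: "x \<rightarrow>\<^sup>*\<^bsub>cone k G\<^esub> Inr 0" if x: "x \<in> verts (cone k G)" for x
  proof (cases x)
    case (Inl u)
    hence "x \<rightarrow>\<^bsub>cone k G\<^esub> Inr 0" using x assms by (auto simp: verts_cone)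
    thus ?thesis by (rule C.reachable_adjI)
  next
    case (Inr i)
    hence "x \<rightarrow>\<^bsub>cone k G\<^esub> Inl w" using x w by (auto simp: verts_cone)
    moreover have "Inl w \<rightarrow>\<^bsub>cone k G\<^esub> Inr 0" using w assms by auto
    ultimately show ?thesis by (blast intro: C.adj_reachable_trans)
  qed
  fix x y assume "x \<in> verts (cone k G)" "y \<in> verts (cone k G)"
  thus "x \<rightarrow>\<^sup>*\<^bsub>cone k G\<^esub> y"
    using apex C.symmetric_reachable' C.reachable_trans by blast
qed

lemma hoffman_colorable_cone_iff:
  assumes "k \<ge> 1" and ne: "verts G \<noteq> {}"
  shows "hoffman_colorable (cone k G) \<longleftrightarrow>
    real (chromatic_number (cone k G)) = 1 - lambda_max (cone k G) / lambda_min (cone k G)"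
proof -
  obtain w where w: "w \<in> verts G" using ne by blast
  have "(Inl w, Inr 0) \<in> arcs (cone k G)"
    using w assms(1) by (auto simp: cone_def cone_graph_def)
  hence "arcs (cone k G) \<noteq> {}" by blast
  thus ?thesis
    using graph.strongly_connected_imp_connected[OF graph_cone strongly_connected_cone[OF assms]]
    by (simp add: hoffman_colorable_def connected_hoffman_colorable_def hoffman_bound_def)
qed

lemma proper_coloring_cone:
  assumes "proper_coloring G m c"
  shows "proper_coloring (cone k G) (Suc m) (case_sum c (\<lambda>_. m))"
  unfolding proper_coloring_def
proof (intro conjI ballI allI impI)
  fix x assume "x \<in> verts (cone k G)"
  thus "case_sum c (\<lambda>_. m) x < Suc m"
    using assms by (auto simp: verts_cone proper_coloring_def less_SucI)
next
  fix x y assume "x \<rightarrow>\<^bsub>cone k G\<^esub> y"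
  thus "case_sum c (\<lambda>_. m) x \<noteq> case_sum c (\<lambda>_. m) y"
    using assms unfolding proper_coloring_def
    by (cases x; cases y) auto
qed

lemma chromatic_number_cone:
  assumes "k \<ge> 1"
  shows "chromatic_number (cone k G) = Suc (chromatic_number G)"
proof (rule antisym)
  interpret C: graph "cone k G" by (rule graph_cone)
  obtain c where "proper_coloring G (chromatic_number G) c" by (rule proper_coloring_chromatic_number)
  thus "chromatic_number (cone k G) \<le> Suc (chromatic_number G)"
    by (rule C.chromatic_number_le[OF proper_coloring_cone])
  define N where "N = chromatic_number (cone k G)"
  obtain c where c: "proper_coloring (cone k G) N c"
    unfolding N_def by (rule C.proper_coloring_chromatic_number)
  let ?p = "c (Inr 0)"
  have p: "?p < N" using c assms by (auto simp: proper_coloring_def verts_cone)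
  have cv: "c (Inl v) < N \<and> c (Inl v) \<noteq> ?p" if "v \<in> verts G" for v
  proof -
    have "Inl v \<rightarrow>\<^bsub>cone k G\<^esub> Inr 0" using that assms by auto
    thus ?thesis using c that unfolding proper_coloring_def verts_cone by blast
  qed
  text \<open>The colour of the apexes is free on \<open>G\<close>, so it can replace the last colour \<open>N - 1\<close>.\<close>
  define c' where "c' = (\<lambda>v. if c (Inl v) = N - 1 then ?p else c (Inl v))"
  have "proper_coloring G (N - 1) c'" unfolding proper_coloring_def
  proof (intro conjI ballI allI impI)
    fix v assume "v \<in> verts G"
    from cv[OF this] p show "c' v < N - 1" by (auto simp: c'_def)
  next
    fix u v assume uv: "u \<rightarrow>\<^bsub>G\<^esub> v"
    have "Inl u \<rightarrow>\<^bsub>cone k G\<^esub> Inl v" using uv by simp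
    hence "c (Inl u) \<noteq> c (Inl v)" using c unfolding proper_coloring_def by blast
    thus "c' u \<noteq> c' v" using cv[OF adj_in_verts(1)[OF uv]] cv[OF adj_in_verts(2)[OF uv]]
      by (auto simp: c'_def)
  qed
  thus "Suc (chromatic_number G) \<le> chromatic_number (cone k G)"
    using chromatic_number_le p unfolding N_def by fastforce
qed

section \<open>Consequences of Hoffman colorability of the cone\<close>

lemma qform_extend_cone:
  "qform (verts G) (adj G) g = qform (verts (cone k G)) (adj (cone k G)) (case_sum g (\<lambda>_. 0))"
  by (simp add: qform_def sum_verts_cone)

text \<open>Here \<open>t\<close> is the negative of the least eigenvalue of the cone. Any optimal
  colouring of \<open>G\<close>, extended by one colour for all apexes, is optimal on the cone, so
  the equality case applies to each of them with the same Perron vector.\<close>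

lemma hoffman_colorable_coneD:
  assumes k: "k \<ge> 1" and arcs: "arcs G \<noteq> {}" and hc: "hoffman_colorable (cone k G)"
  obtains t where "t > 0"
    and "\<And>g. - t * (\<Sum>v\<in>verts G. (g v)\<^sup>2) \<le> qform (verts G) (adj G) g"
    and "\<And>c v i. \<lbrakk>proper_coloring G (chromatic_number G) c; v \<in> verts G;
      i < chromatic_number G; i \<noteq> c v\<rbrakk> \<Longrightarrow>
      (\<Sum>u\<in>verts G. if c u = i then adj G v u else 0) = t"
    and "\<And>c i. \<lbrakk>proper_coloring G (chromatic_number G) c; i < chromatic_number G\<rbrakk> \<Longrightarrow>
      real (card (color_class G c i)) = t\<^sup>2 / real k"
proof -
  let ?V = "verts G"
  define T where "T = lambda_min (cone k G)"
  define L where "L = lambda_max (cone k G)"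
  define m where "m = chromatic_number G"
  interpret C: graph "cone k G" by (rule graph_cone)
  have ne: "?V \<noteq> {}" using arcs tail_in_verts by blast
  hence neC: "verts (cone k G) \<noteq> {}" by (auto simp: verts_cone)
  have m: "m \<ge> 2" using chromatic_number_ge2[OF arcs] by (simp add: m_def)
  have "real (Suc m) = 1 - L / T"
    using hc hoffman_colorable_cone_iff[OF k ne] chromatic_number_cone[OF k]
    by (simp add: m_def L_def T_def)
  hence mLT: "real m = - (L / T)" by simp
  \<comment> \<open>For \<open>T = 0\<close> the quotient would be 0 by convention, contradicting m
    \<ge> 2.\<close>
  hence T0: "T \<noteq> 0" using m by auto
  have L: "L = (1 - real (Suc m)) * T" using mLT T0 by (simp add: field_simps)
  obtain f where f: "eigenfunction (cone k G) L f" and nonneg: "\<And>x. f x \<ge> 0"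
    using C.ex_nonneg_eigenfunction_lambda_max[OF neC] by (auto simp: L_def)
  \<comment> \<open>The class sums of the cone, split into vertices of \<open>G\<close> and
    apexes.\<close>
  have cls: "(\<Sum>v\<in>?V. if c v = i then adj (cone k G) x (Inl v) * f (Inl v) else 0) +
      (\<Sum>j<k. if m = i then adj (cone k G) x (Inr j) * f (Inr j) else 0) =
      (if case_sum c (\<lambda>_. m) x = i then 0 else - T * f x)"
    if "proper_coloring G m c" "i < Suc m" "x \<in> verts (cone k G)" for c i x
    using C.hoffman_equality_class_sum[OF proper_coloring_cone[OF that(1)] f L[unfolded T_def] that(2,3)]
    by (simp add: T_def sum_verts_cone)
  obtain c0 where c0: "proper_coloring G m c0"
    unfolding m_def by (rule proper_coloring_chromatic_number)
  define P where "P = (\<Sum>i<k. f (Inr i))"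
  define a where "a = - P / T"
  \<comment> \<open>Class \<open>m\<close> consists exactly of the apexes, all adjacent to
    \<open>v\<close>, so its class sum at \<open>v\<close> is \<open>P\<close> whatever
    \<open>v\<close> is.\<close>
  have fa: "f (Inl v) = a" if v: "v \<in> ?V" for v
  proof -
    have "c0 u \<noteq> m" if "u \<in> ?V" for u using c0 that by (auto simp: proper_coloring_def)
    hence "P = - T * f (Inl v)"
      using cls[OF c0, of m "Inl v"] v
      by (simp add: verts_cone P_def)
    thus ?thesis using T0 by (simp add: a_def)
  qed
  define n where "n = real (card ?V)"
  have n: "n > 0" using ne by (simp add: n_def card_gt_0_iff)
  have apex: "L * f (Inr i) = n * a" if "i < k" for i
    using f that by (simp add: eigenfunction_cone_iff fa n_def)
  \<comment> \<open>If \<open>a\<close> were 0, the nonnegative apex entries would have sum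
    \<open>P = 0\<close>, and \<open>f\<close> would vanish everywhere.\<close>
  have a: "a > 0"
  proof -
    obtain v where v: "v \<in> ?V" using ne by blast
    have "a \<noteq> 0"
    proof
      assume "a = 0"
      hence "P = 0" using T0 by (simp add: a_def)
      hence "\<forall>i<k. f (Inr i) = 0" using nonneg by (simp add: P_def sum_nonneg_eq_0_iff)
      thus False using f fa \<open>a = 0\<close> by (auto simp: eigenfunction_cone_iff)
    qed
    thus ?thesis using nonneg[of "Inl v"] fa[OF v] by simp
  qed
  define b where "b = f (Inr 0)"
  have Lb: "L * b = n * a" using apex k by (simp add: b_def)
  hence L0: "L \<noteq> 0" using n a by auto
  have fb: "f (Inr i) = b" if "i < k" for i using apex[OF that] Lb L0 by (metis mult_left_cancel)
  hence P: "P = real k * b" by (simp add: P_def)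
  have "b > 0" using nonneg[of "Inr 0"] Lb n a by (auto simp: b_def less_le)
  have kb: "real k * b = - T * a" using P T0 by (simp add: a_def field_simps)
  moreover have "real k * b > 0" using k \<open>b > 0\<close> by simp
  \<comment> \<open>The equation \<open>k b = - T a\<close> has a positive left side, and
    \<open>a\<close> is positive.\<close>
  ultimately have T: "T < 0" using a by (simp add: zero_less_mult_iff mult_less_0_iff)
  show ?thesis
  proof (rule that[of "- T"])
    show "- T > 0" using T by simp
    show "- (- T) * (\<Sum>v\<in>?V. (g v)\<^sup>2) \<le> qform ?V (adj G) g" for g
      using C.lambda_min_qform[OF neC, of "case_sum g (\<lambda>_. 0)"]
      by (simp add: T_def sum_verts_cone flip: qform_extend_cone)
    fix c i assume c: "proper_coloring G (chromatic_number G) c" and i: "i < chromatic_number G"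
    show "(\<Sum>u\<in>?V. if c u = i then adj G v u else 0) = - T" if v: "v \<in> ?V" "i \<noteq> c v" for v
    proof -
      have "(\<Sum>u\<in>?V. if c u = i then adj G v u else 0) * a =
          (\<Sum>u\<in>?V. if c u = i then adj G v u * f (Inl u) else 0)"
        unfolding sum_distrib_right by (intro sum.cong) (auto simp: fa)
      also have "\<dots> = - T * a"
        using cls[of c i "Inl v"] c i v
        by (simp add: verts_cone fa m_def cong: if_cong)
      finally show ?thesis using a unfolding mult_cancel_right by simp
    qed
    \<comment> \<open>An apex sees the whole class \<open>i\<close>, so its class sum there is the
      class size times \<open>a\<close>. Multiplying by \<open>k\<close> and using \<open>kb\<close>
      eliminates \<open>b\<close>.\<close>
    have "real (card (color_class G c i)) * a = (\<Sum>u\<in>?V. if c u = i then f (Inl u) else 0)"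
      unfolding card_color_class sum_distrib_right by (intro sum.cong) (auto simp: fa)
    also have "\<dots> = - T * b"
    proof -
      have "(\<Sum>u\<in>?V. if c u = i then f (Inl u) else 0) =
          (\<Sum>u\<in>?V. if c u = i then adj (cone k G) (Inr 0) (Inl u) * f (Inl u) else 0)"
        using k by (intro sum.cong) auto
      thus ?thesis using cls[of c i "Inr 0"] c i k
        by (simp add: verts_cone m_def b_def)
    qed
    finally have card: "real (card (color_class G c i)) * a = - T * b" .
    have "real k * real (card (color_class G c i)) * a =
        real k * (real (card (color_class G c i)) * a)" by simp
    also have "\<dots> = - T * (real k * b)" unfolding card by simp
    also have "\<dots> = T\<^sup>2 * a" unfolding kb by (simp add: power2_eq_square)
    finally show "real (card (color_class G c i)) = (- T)\<^sup>2 / real k"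
      using a k by (simp add: field_simps)
  qed
qed

section \<open>Spectrum of the cone over a regular graph\<close>

text \<open>
  On functions constant on \<open>G\<close> and on the apexes, the cone has the quotient matrix with rows
  \<open>(d, k)\<close> and \<open>(n, 0)\<close>. The size condition makes \<open>\<tau> = \<lambda>\<^sub>m\<^sub>i\<^sub>n G\<close> and \<open>d - \<tau>\<close> its eigenvalues.
\<close>
lemma regular_cone_spectrum:
  assumes k: "k \<ge> 1" and ne: "verts G \<noteq> {}"
    and deg: "\<And>v. v \<in> verts G \<Longrightarrow> (\<Sum>u\<in>verts G. adj G v u) = d"
    and neg: "lambda_min G < 0"
    and size: "real (card (verts G)) * real k = lambda_min G * (lambda_min G - d)"
  shows "lambda_max (cone k G) = d - lambda_min G" "lambda_min (cone k G) = lambda_min G"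
proof -
  let ?V = "verts G" and ?t = "lambda_min G"
  interpret C: graph "cone k G" by (rule graph_cone)
  obtain v where v: "v \<in> ?V" using ne by blast
  have d: "d \<ge> 0" using deg[OF v] by (auto simp: adj_def intro: sum_nonneg)
  \<comment> \<open>The base equation holds identically, the apex equation is \<open>size\<close>;
    the entries are positive because \<open>lambda_min G\<close> is negative.\<close>
  have "eigenfunction (cone k G) (d - ?t) (case_sum (\<lambda>_. real k) (\<lambda>_. - ?t))"
    using v k size deg
    by (auto simp: eigenfunction_cone_iff algebra_simps simp flip: sum_distrib_left)
  thus "lambda_max (cone k G) = d - ?t"
  proof (rule C.pos_eigenfunction_lambda_max)
    fix x assume "x \<in> verts (cone k G)"
    thus "case_sum (\<lambda>_. real k) (\<lambda>_. - ?t) x > 0" using k neg by (auto split: sum.splits)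
  qed
  have "eigenfunction (cone k G) ?t (case_sum (\<lambda>_. real k) (\<lambda>_. ?t - d))"
    using v k size deg
    by (auto simp: eigenfunction_cone_iff algebra_simps simp flip: sum_distrib_left)
  thus "lambda_min (cone k G) = ?t"
  proof (rule C.lambda_min_eqI)
    fix y g assume g: "eigenfunction (cone k G) y g"
    \<comment> \<open>The totals of \<open>g\<close> over \<open>G\<close> and over the apexes
      satisfy the equations of the transposed quotient matrix, obtained below by summing the
      eigenvalue equations.\<close>
    define S where "S = (\<Sum>v\<in>?V. g (Inl v))"
    define P where "P = (\<Sum>i<k. g (Inr i))"
    have gG: "(\<Sum>v\<in>?V. adj G u v * g (Inl v)) + P = y * g (Inl u)" if "u \<in> ?V" for u
      using g that by (simp add: eigenfunction_cone_iff P_def)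
    have gA: "S = y * g (Inr i)" if "i < k" for i
      using g that by (simp add: eigenfunction_cone_iff S_def)
    have "(\<Sum>u\<in>?V. \<Sum>v\<in>?V. adj G u v * g (Inl v)) = (\<Sum>v\<in>?V. (\<Sum>u\<in>?V. adj G v u) * g (Inl v))"
      by (subst sum.swap) (simp add: adj_sym sum_distrib_right)
    also have "\<dots> = d * S" by (simp add: deg S_def sum_distrib_left)
    finally have AS: "(\<Sum>u\<in>?V. \<Sum>v\<in>?V. adj G u v * g (Inl v)) = d * S" .
    have 1: "d * S + real (card ?V) * P = y * S"
    proof -
      have "(\<Sum>u\<in>?V. (\<Sum>v\<in>?V. adj G u v * g (Inl v)) + P) = (\<Sum>u\<in>?V. y * g (Inl u))"
        by (rule sum.cong[OF refl gG])
      thus ?thesis using AS by (simp add: sum.distrib S_def flip: sum_distrib_left)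
    qed
    have 2: "real k * S = y * P"
    proof -
      have "(\<Sum>i<k. S) = (\<Sum>i<k. y * g (Inr i))" by (intro sum.cong refl gA) simp
      thus ?thesis by (simp add: P_def flip: sum_distrib_left)
    qed
    show "?t \<le> y"
    proof (rule ccontr)
      assume "\<not> ?t \<le> y"
      hence y: "y < ?t" by simp
      hence y0: "y \<noteq> 0" using neg by simp
      show False
      proof (cases "S = 0")
        case True
        \<comment> \<open>Here \<open>g\<close> vanishes on the apexes and is an eigenfunction of
          \<open>G\<close> itself, so \<open>y\<close> cannot lie below
          \<open>lambda_min G\<close>.\<close>
        hence "P = 0" "\<And>i. i < k \<Longrightarrow> g (Inr i) = 0" using 2 gA y0 by auto
        hence "eigenfunction G y (g \<circ> Inl)"
          using g gG unfolding eigenfunction_cone_iff by (auto simp: eigenfunction_def)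
        from lambda_min_le[OF this] y show False by simp
      next
        case False
        have "d * y * S + (real (card ?V) * real k) * S = d * y * S + real (card ?V) * (y * P)"
          by (simp flip: 2)
        also have "\<dots> = y * (d * S + real (card ?V) * P)" by (simp add: algebra_simps)
        also have "\<dots> = y * y * S" by (simp add: 1)
        \<comment> \<open>Eliminating \<open>P\<close> leaves the characteristic equation of the
          quotient matrix; both factors are negative since \<open>y < ?t\<close>,
          \<open>?t < 0\<close> and d \<ge> 0.\<close>
        finally have "(y - ?t) * (y + ?t - d) * S = 0"
          unfolding size by (simp add: algebra_simps)
        thus False using False y neg d by simp
      qed
    qed
  qed
qed

end

section \<open>The two directions of the equivalence\<close>

theorem theorem3p8:
  fixes G :: "('a, 'b) pre_digraph" and k :: nat
  assumes "k \<ge> 1" and "graph G" and "arcs G \<noteq> {}"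
  shows "hoffman_colorable (with_proj (cone_graph k G)) \<longleftrightarrow>
         regular_graph G \<and> hoffman_colorable G \<and>
         (\<forall>c. hoffman_coloring G c \<longrightarrow>
            (\<forall>i < chromatic_number G.
               real (card (color_class G c i)) = (lambda_min G)\<^sup>2 / real k))"
proof -
  interpret graph G by fact
  let ?m = "chromatic_number G"
  have ne: "verts G \<noteq> {}" using \<open>arcs G \<noteq> {}\<close> tail_in_verts by blast
  have m: "?m \<ge> 2" by (rule chromatic_number_ge2) fact
  obtain c where c: "proper_coloring G ?m c" by (rule proper_coloring_chromatic_number)
  have "hoffman_colorable (cone k G) \<longleftrightarrow> regular_graph G \<and> hoffman_colorable G \<and>
       (\<forall>c. hoffman_coloring G c \<longrightarrow>
          (\<forall>i < ?m. real (card (color_class G c i)) = (lambda_min G)\<^sup>2 / real k))"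
    (is "_ \<longleftrightarrow> ?R")
  proof
    assume hc: "hoffman_colorable (cone k G)"
    obtain t where t: "t > 0"
      and le: "\<And>g. - t * (\<Sum>v\<in>verts G. (g v)\<^sup>2) \<le> qform (verts G) (adj G) g"
      and nb: "\<And>c v i. \<lbrakk>proper_coloring G ?m c; v \<in> verts G; i < ?m; i \<noteq> c v\<rbrakk> \<Longrightarrow>
        (\<Sum>u\<in>verts G. if c u = i then adj G v u else 0) = t"
      and size: "\<And>c i. \<lbrakk>proper_coloring G ?m c; i < ?m\<rbrakk> \<Longrightarrow>
        real (card (color_class G c i)) = t\<^sup>2 / real k"
      by (rule hoffman_colorable_coneD[OF assms(1,3) hc]) (rule that)
    \<comment> \<open>This turns the class size \<open>t^2 / k\<close> into the one of the
      statement.\<close>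
    have min: "lambda_min G = - t"
      by (rule equitable_coloring_spectrum(2)[OF ne c m t nb[OF c] le])
    have deg: "(\<Sum>u\<in>verts G. adj G v u) = t * (real ?m - 1)" if "v \<in> verts G" for v
      by (rule equitable_coloring_spectrum(4)[OF ne c m t nb[OF c] le that])
    have "regular_graph G" unfolding regular_graph_def
    proof -
      have "real (out_degree G v) = t * (real ?m - 1)" if "v \<in> verts G" for v
        using deg[OF that] by (simp add: out_degree_eq_sum)
      thus "\<exists>d. \<forall>v\<in>verts G. out_degree G v = d" using ne by (metis of_nat_eq_iff)
    qed
    moreover have "hoffman_colorable G"
      by (rule equitable_coloring_hoffman_colorable[OF ne c m t nb[OF c] le])
    ultimately show ?R
      using size min by (simp add: hoffman_coloring_def)
  next
    assume R: ?R
    let ?t = "lambda_min G"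
    obtain d where "\<And>v. v \<in> verts G \<Longrightarrow> out_degree G v = d"
      using R by (auto simp: regular_graph_def)
    hence deg: "(\<Sum>u\<in>verts G. adj G v u) = real d" if "v \<in> verts G" for v
      using that by (simp flip: out_degree_eq_sum)
    have hb: "real ?m = 1 - real d / ?t"
      using R ne deg by (intro regular_hoffman_colorable) auto
    \<comment> \<open>Otherwise the quotient in \<open>hb\<close> is nonnegative (0 when
      \<open>?t = 0\<close>), and the chromatic number would be at most 1.\<close>
    have neg: "?t < 0"
    proof (rule ccontr)
      assume "\<not> ?t < 0"
      hence "real d / ?t \<ge> 0" by simp
      thus False using hb m by linarith
    qed
    have mt: "real ?m * ?t = ?t - real d" using neg by (simp add: hb field_simps)
    \<comment> \<open>Counting vertices by colour classes gives the product of \<open>k\<close> and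
      the order of \<open>G\<close>; \<open>mt\<close> then brings it into the form needed for the
      spectrum of the cone.\<close>
    have "real (card (verts G)) = (\<Sum>i<?m. real (card (color_class G c i)))"
      unfolding card_color_class by (simp add: sum_color_classes[OF c])
    also have "\<dots> = (\<Sum>i<?m. ?t\<^sup>2 / real k)"
      using R c by (simp add: hoffman_coloring_def)
    finally have "real (card (verts G)) * real k = ?t * (real ?m * ?t)"
      using assms(1) by (simp add: field_simps power2_eq_square)
    hence size: "real (card (verts G)) * real k = ?t * (?t - real d)" by (simp only: mt)
    have spec: "lambda_max (cone k G) = real d - ?t" "lambda_min (cone k G) = ?t"
      using regular_cone_spectrum[OF assms(1) ne deg neg size] by auto
    have "1 - (real d - ?t) / ?t = 1 + real ?m"
      using mt neg by (simp add: field_simps)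
    thus "hoffman_colorable (cone k G)"
      unfolding hoffman_colorable_cone_iff[OF assms(1) ne] chromatic_number_cone[OF assms(1)] spec
      by simp
  qed
  thus ?thesis by (simp only: cone_def)
qed

end
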